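(* Let $X_1,X_2,\dots,X_n$ be Boolean independent identically distributed copies of a random variable $X$, let $L=\sum_{i=1}^n\alpha_iX_i$ be a linear form with real coefficients and $\varphi(L)=0$, and let $P=\sum_{\sigma\in\mathfrak S_n}L_\sigma^2$. Then for every $r\in\mathbb N$ $$K_r(P)=n\,\big((n-1)!\big)^r(\alpha_1^2+\dots+\alpha_n^2)^r\,K_{2r}(X).$$ In the case of the sample variance $Q_n=\sum_{i=1}^n(X_i-\overline X)^2$, where $\overline X=\frac1n\sum_{i=1}^nX_i$, one has for every $r\in\mathbb N$ $$K_r(Q_n)=n\Big(1-\frac1n\Big)^rK_{2r}(X).$$
   Context: A noncommutative probability space is a pair $(\mathcal A,\varphi)$ with $\mathcal A$ a unital $*$-algebra and $\varphi$ a normal state; random variables are self-adjoint elements. Subalgebras $(\mathcal A_i)$ are Boolean independent if $\varphi(X_1\cdots X_m)=\varphi(X_1)\cdots\varphi(X_m)$ whenever $X_j\in\mathcal A_{i(j)}$ with consecutive indices $i(j)\neq i(j+1)$; random variables are Boolean independent if the (not necessarily unital) subalgebras they generate are. $\mathcal I(n)$ is the set of interval partitions of $\{1,\dots,n\}$ (blocks consist of consecutive integers). Boolean cumulants $K_n$ are the multilinear functionals defined by $\varphi(X_1\cdots X_n)=\sum_{\pi\in\mathcal I(n)}\prod_{B\in\pi}K_{|B|}(X_i:i\in B)$; $K_n(X)=K_n(X,\dots,X)$. Identically distributed means all cumulants coincide. $\mathfrak S_n$ is the symmetric group and, for $\sigma\in\mathfrak S_n$, $L_\sigma=\sum_{i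=1}^n\alpha_iX_{\sigma(i)}$.
   Formalization: The first formula is false under φ(L)=0 alone (e.g. n=1, φ(X)=0, K_3(X)≠0, r=3); it is proved under the additional assumption that α_1+…+α_n=0 or all odd cumulants of X vanish. The sample variance formula is proved without extra assumption. *)

theory Defs
  imports Complex_Main "HOL-Library.Disjoint_Sets" "HOL-Combinatorics.Permutations"
begin

class unital_star_algebra = ring_1 +
  fixes scaleC :: "complex \<Rightarrow> 'a \<Rightarrow> 'a" (infixr "*\<^sub>C" 75)
    and star :: "'a \<Rightarrow> 'a"
  assumes scaleC_add_right: "c *\<^sub>C (x + y) = c *\<^sub>C x + c *\<^sub>C y"
    and scaleC_add_left: "(c + d) *\<^sub>C x = c *\<^sub>C x + d *\<^sub>C x"
    and scaleC_scaleC: "c *\<^sub>C d *\<^sub>C x = (c * d) *\<^sub>C x"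
    and scaleC_one: "1 *\<^sub>C x = x"
    and mult_scaleC_left: "(c *\<^sub>C x) * y = c *\<^sub>C (x * y)"
    and mult_scaleC_right: "x * (c *\<^sub>C y) = c *\<^sub>C (x * y)"
    and star_add: "star (x + y) = star x + star y"
    and star_scaleC: "star (c *\<^sub>C x) = cnj c *\<^sub>C star x"
    and star_mult: "star (x * y) = star y * star x"
    and star_star: "star (star x) = x"

text \<open>Normality of a state refers to a von Neumann algebra structure. On a bare unital star-algebra
  there is nothing to be continuous for, so only positivity and normalisation are required;
  every normal state satisfies this predicate.\<close>

definition is_state :: "('a::unital_star_algebra \<Rightarrow> complex) \<Rightarrow> bool" where
  "is_state \<phi> \<longleftrightarrow>
     (\<forall>x y. \<phi> (x + y) = \<phi> x + \<phi> y) \<and>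
     (\<forall>c x. \<phi> (c *\<^sub>C x) = c * \<phi> x) \<and>
     (\<forall>x. Im (\<phi> (star x * x)) = 0 \<and> 0 \<le> Re (\<phi> (star x * x))) \<and>
     \<phi> 1 = 1"

definition self_adjoint :: "'a::unital_star_algebra \<Rightarrow> bool" where
  "self_adjoint x \<longleftrightarrow> star x = x"

text \<open>The generated subalgebra need not contain the unit. For self-adjoint generators it is
  automatically closed under the involution.\<close>

inductive_set generated_subalgebra :: "'a::unital_star_algebra set \<Rightarrow> 'a set" for S where
  generator: "x \<in> S \<Longrightarrow> x \<in> generated_subalgebra S"
| zero: "0 \<in> generated_subalgebra S"
| add: "x \<in> generated_subalgebra S \<Longrightarrow> y \<in> generated_subalgebra S \<Longrightarrow> x + y \<in> generated_subalgebra S"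
| scaleC: "x \<in> generated_subalgebra S \<Longrightarrow> c *\<^sub>C x \<in> generated_subalgebra S"
| mult: "x \<in> generated_subalgebra S \<Longrightarrow> y \<in> generated_subalgebra S \<Longrightarrow> x * y \<in> generated_subalgebra S"

definition boolean_indep_subalgebras ::
  "('a::unital_star_algebra \<Rightarrow> complex) \<Rightarrow> 'i set \<Rightarrow> ('i \<Rightarrow> 'a set) \<Rightarrow> bool" where
  "boolean_indep_subalgebras \<phi> I A \<longleftrightarrow>
     (\<forall>m (i :: nat \<Rightarrow> 'i) (Y :: nat \<Rightarrow> 'a).
        (\<forall>j<m. i j \<in> I \<and> Y j \<in> A (i j)) \<and> (\<forall>j. Suc j < m \<longrightarrow> i j \<noteq> i (Suc j)) \<longrightarrow>
        \<phi> (prod_list (map Y [0..<m])) = (\<Prod>j<m. \<phi> (Y j)))"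

definition boolean_indep ::
  "('a::unital_star_algebra \<Rightarrow> complex) \<Rightarrow> 'i set \<Rightarrow> ('i \<Rightarrow> 'a) \<Rightarrow> bool" where
  "boolean_indep \<phi> I X \<longleftrightarrow> boolean_indep_subalgebras \<phi> I (\<lambda>i. generated_subalgebra {X i})"

text \<open>Positions are counted from 0, so that a block \<open>B\<close> of an interval partition selects the
  sublist \<open>nths xs B\<close>.\<close>

definition interval_partitions :: "nat \<Rightarrow> nat set set set" where
  "interval_partitions n = {\<pi>. partition_on {..<n} \<pi> \<and> (\<forall>B\<in>\<pi>. \<exists>a b. B = {a..<b})}"

lemma finite_interval_partitions: "finite (interval_partitions n)"
proof (rule finite_subset)
  show "interval_partitions n \<subseteq> Pow (Pow {..<n})"
    by (auto simp: interval_partitions_def partition_on_def)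
qed auto

lemma interval_partitions_block_small:
  assumes "\<pi> \<in> interval_partitions n - {{{..<n}}}" "B \<in> \<pi>"
  shows "B \<subset> {..<n}"
proof (rule psubsetI)
  have p: "partition_on {..<n} \<pi>" using assms by (auto simp: interval_partitions_def)
  show "B \<subseteq> {..<n}" using p assms(2) by (auto simp: partition_on_def)
  show "B \<noteq> {..<n}"
  proof
    assume B: "B = {..<n}"
    have "C = B" if "C \<in> \<pi>" for C
    proof (rule ccontr)
      assume "C \<noteq> B"
      then have "C \<inter> B = {}" using p that assms(2) by (auto simp: partition_on_def disjoint_def)
      moreover have "C \<subseteq> B" "C \<noteq> {}" using p that B by (auto simp: partition_on_def)
      ultimately show False by blast
    qed
    then have "\<pi> = {{..<n}}" using assms(2) B by blast
    then show False using assms(1) by simp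
  qed
qed

text \<open>The moment-cumulant formula, solved for the term of the one-block partition; see
  \<open>moment_boolean_cumulant\<close> below.\<close>

function boolean_cumulant :: "('a::unital_star_algebra \<Rightarrow> complex) \<Rightarrow> 'a list \<Rightarrow> complex" where
  "boolean_cumulant \<phi> xs =
     \<phi> (prod_list xs) -
     (\<Sum>\<pi> \<in> interval_partitions (length xs) - {{{..<length xs}}}.
        \<Prod>B\<in>\<pi>. boolean_cumulant \<phi> (nths xs B))"
  by auto
termination
proof (relation "measure (\<lambda>(\<phi>, xs). length xs)")
  fix \<phi> :: "'a \<Rightarrow> complex" and xs :: "'a list" and \<pi> B
  assume "\<pi> \<in> interval_partitions (length xs) - {{{..<length xs}}}" "B \<in> \<pi>"
  then have B: "B \<subset> {..<length xs}" by (rule interval_partitions_block_small)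
  then have "{i. i < length xs \<and> i \<in> B} = B" by auto
  then have "length (nths xs B) < length xs"
    using psubset_card_mono[OF _ B] by (simp add: length_nths)
  then show "((\<phi>, nths xs B), (\<phi>, xs)) \<in> measure (\<lambda>(\<phi>, xs). length xs)" by simp
qed auto

declare boolean_cumulant.simps [simp del]

lemma moment_boolean_cumulant:
  assumes "xs \<noteq> []"
  shows "\<phi> (prod_list xs) =
    (\<Sum>\<pi> \<in> interval_partitions (length xs). \<Prod>B\<in>\<pi>. boolean_cumulant \<phi> (nths xs B))"
proof -
  let ?n = "length xs"
  have "partition_on {..<?n} {{..<?n}}"
    using assms by (intro partition_on_space) auto
  moreover have "\<exists>a b. {..<?n} = {a..<b}" by (metis lessThan_atLeast0)
  ultimately have "{{..<?n}} \<in> interval_partitions ?n" by (simp add: interval_partitions_def)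
  moreover have "nths xs {..<?n} = xs" by (simp add: nths_upt_eq_take)
  ultimately show ?thesis
    by (subst sum.remove[OF finite_interval_partitions])
       (auto simp: boolean_cumulant.simps[of \<phi> xs])
qed

text \<open>\<open>K\<^sub>r(x) = K\<^sub>r(x, \<dots>, x)\<close>, meaningful for \<open>r \<ge> 1\<close>.\<close>

definition boolean_cumulant1 :: "('a::unital_star_algebra \<Rightarrow> complex) \<Rightarrow> nat \<Rightarrow> 'a \<Rightarrow> complex" where
  "boolean_cumulant1 \<phi> r x = boolean_cumulant \<phi> (replicate r x)"

text \<open>The two variables may live in different noncommutative probability spaces.\<close>

definition identically_distributed ::
  "('a::unital_star_algebra \<Rightarrow> complex) \<Rightarrow> 'a \<Rightarrow> ('b::unital_star_algebra \<Rightarrow> complex) \<Rightarrow> 'b \<Rightarrow> bool" where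
  "identically_distributed \<phi> x \<psi> y \<longleftrightarrow>
     (\<forall>r\<ge>1. boolean_cumulant1 \<phi> r x = boolean_cumulant1 \<psi> r y)"

definition permuted_linear_form ::
  "nat \<Rightarrow> (nat \<Rightarrow> real) \<Rightarrow> (nat \<Rightarrow> 'a::unital_star_algebra) \<Rightarrow> (nat \<Rightarrow> nat) \<Rightarrow> 'a" where
  "permuted_linear_form n \<alpha> X \<sigma> = (\<Sum>i=1..n. complex_of_real (\<alpha> i) *\<^sub>C X (\<sigma> i))"

definition sample_mean :: "nat \<Rightarrow> (nat \<Rightarrow> 'a::unital_star_algebra) \<Rightarrow> 'a" where
  "sample_mean n X = (1 / of_nat n) *\<^sub>C (\<Sum>i=1..n. X i)"

definition sample_variance :: "nat \<Rightarrow> (nat \<Rightarrow> 'a::unital_star_algebra) \<Rightarrow> 'a" where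
  "sample_variance n X = (\<Sum>i=1..n. (X i - sample_mean n X)\<^sup>2)"

end

theory Submission imports Defs begin

text \<open>
  By the symmetry under permutations, both quadratic forms lie in the span of
  \<open>Q = \<Sum>X\<^sub>a\<^sup>2\<close> and \<open>S\<^sup>2\<close> with \<open>S = \<Sum>X\<^sub>a\<close>, say \<open>P = e Q + d S\<^sup>2\<close>; in other words
  \<open>P = \<Sum>c\<^sub>a\<^sub>b X\<^sub>a X\<^sub>b\<close> where the matrix \<open>c\<close> has diagonal entries \<open>e + d\<close> and all row sums equal
  to \<open>e + n d\<close>. Writing \<open>s\<close> for the sum of the coefficients, the row sum is \<open>(n - 1)! s\<^sup>2\<close> for
  the symmetrised square of a linear form, and it is \<open>0\<close> for the sample variance. Under the
  hypotheses, the row sum times any odd cumulant of \<open>X\<close> therefore vanishes.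

  Boolean cumulants are computed by alternately multiplying by a variable and centering:
  \<open>K(x\<^sub>1, \<dots>, x\<^sub>r) = \<phi>(x\<^sub>1 \<pi>(x\<^sub>2 \<pi>(\<dots> \<pi>(x\<^sub>r))))\<close> with \<open>\<pi>(y) = y - \<phi>(y) 1\<close>
  (\<open>boolean_cumulant_Cons\<close>). Hence \<open>K\<^sub>r(P)\<close> is read off from the orbit of \<open>1\<close> under
  \<open>y \<mapsto> \<pi>(P y)\<close>. Elements need only be known up to what words in the \<open>X\<^sub>a\<close>, multiplied from the
  left, detect through \<open>\<phi>\<close>; this is a left-module congruence. Modulo it, Boolean independence says
  that \<open>X\<^sub>b\<close> annihilates every centered element of the algebra of \<open>X\<^sub>a\<close> for \<open>b \<noteq> a\<close>
  (\<open>mult_U_other\<close>): this is the action of Boolean independent variables on a vacuum vector and a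
  direct sum of orthogonal spaces. With \<open>W\<^sub>m = \<Sum>\<^sub>a \<pi>(X\<^sub>a \<pi>(X\<^sub>a \<dots>))\<close> (\<open>m\<close> factors) for \<open>m > 0\<close>,
  and \<open>W\<^sub>0 = 1\<close>, one gets
  \<open>P W\<^sub>m \<equiv> (e + d) (W\<^sub>m\<^sub>+\<^sub>2 + n K\<^sub>m\<^sub>+\<^sub>2(X) 1) + (e + n d) K\<^sub>m\<^sub>+\<^sub>1(X) S\<close>.
  The last term vanishes for even \<open>m\<close>, so the orbit of \<open>1\<close> is \<open>(e + d)\<^sup>k W\<^sub>2\<^sub>k\<close> and
  \<open>K\<^sub>r(P) = n (e + d)\<^sup>r K\<^sub>2\<^sub>r(X)\<close> (\<open>cumulant_symmetric_quadratic_form\<close>).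
\<close>

section \<open>Complex scalars and states\<close>

interpretation scaleC: vector_space "scaleC :: complex \<Rightarrow> 'a::unital_star_algebra \<Rightarrow> 'a"
  by standard (simp_all add: scaleC_add_right scaleC_add_left scaleC_scaleC scaleC_one)

lemma sum_constant_scaleC: "(\<Sum>a\<in>A. y) = of_nat (card A) *\<^sub>C (y::'a::unital_star_algebra)"
proof -
  have "of_nat k * y = of_nat k *\<^sub>C y" for k
    by (induction k) (simp_all add: algebra_simps scaleC_add_left)
  then show ?thesis by simp
qed

context
  fixes \<phi> :: "'a::unital_star_algebra \<Rightarrow> complex"
  assumes state: "is_state \<phi>"
begin

lemma state_add: "\<phi> (y + z) = \<phi> y + \<phi> z"
  using state by (simp add: is_state_def)

lemma state_scaleC: "\<phi> (c *\<^sub>C y) = c * \<phi> y"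
  using state by (simp add: is_state_def)

lemma state_one: "\<phi> 1 = 1"
  using state by (simp add: is_state_def)

lemma state_zero: "\<phi> 0 = 0"
  using state_add[of 0 0] by simp

lemma state_diff: "\<phi> (y - z) = \<phi> y - \<phi> z"
  using state_add[of "y - z" z] by simp

lemma state_sum: "\<phi> (\<Sum>i\<in>A. f i) = (\<Sum>i\<in>A. \<phi> (f i))"
  by (induction A rule: infinite_finite_induct) (simp_all add: state_add state_zero)

end

section \<open>Boolean cumulants as iterated centered products\<close>

text \<open>The left end point is free so that removing the first block stays within the family,
  with no shift of the remaining positions.\<close>

definition interval_partitions_from :: "nat \<Rightarrow> nat \<Rightarrow> nat set set set" where
  "interval_partitions_from a n =
     {\<pi>. partition_on {a..<n} \<pi> \<and> (\<forall>B\<in>\<pi>. \<exists>c d. B = {c..<d})}"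

text \<open>An interval partition is determined by the right end of its first block and the interval
  partition that it induces on what follows.\<close>

lemma sum_interval_partitions_first_block:
  fixes f :: "nat set \<Rightarrow> 'c::comm_semiring_1"
  assumes "a < n"
  shows "(\<Sum>\<pi>\<in>interval_partitions_from a n. \<Prod>B\<in>\<pi>. f B)
    = (\<Sum>j\<in>{a<..n}. f {a..<j} * (\<Sum>\<pi>\<in>interval_partitions_from j n. \<Prod>B\<in>\<pi>. f B))"
proof -
  have fin: "finite (interval_partitions_from j n)" for j
    by (rule finite_subset[of _ "Pow (Pow {j..<n})"]) (auto simp: interval_partitions_from_def partition_on_def)
  have fresh: "{a..<j} \<notin> \<pi>" "finite \<pi>" "disjnt {a..<j} (\<Union>\<pi>)" "\<Union>\<pi> = {j..<n}"
    if "\<pi> \<in> interval_partitions_from j n" "a < j" for j \<pi>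
  proof -
    have u: "\<Union>\<pi> = {j..<n}" using that by (simp add: interval_partitions_from_def partition_on_def)
    show "{a..<j} \<notin> \<pi>"
    proof
      assume "{a..<j} \<in> \<pi>"
      then have "a \<in> {j..<n}" using u that(2) by (metis UnionI atLeastLessThan_iff order_refl)
      then show False using that(2) by simp
    qed
    show "finite \<pi>" using u by (metis finite_UnionD finite_atLeastLessThan)
    show "disjnt {a..<j} (\<Union>\<pi>)" unfolding u by (auto simp: disjnt_def)
    show "\<Union>\<pi> = {j..<n}" by (rule u)
  qed
  have bij: "bij_betw (\<lambda>(j, \<pi>). insert {a..<j} \<pi>) (Sigma {a<..n} (\<lambda>j. interval_partitions_from j n)) (interval_partitions_from a n)"
  proof (rule bij_betw_imageI)
    show "inj_on (\<lambda>(j, \<pi>). insert {a..<j} \<pi>) (Sigma {a<..n} (\<lambda>j. interval_partitions_from j n))"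
    proof (rule inj_onI, clarsimp)
      fix j \<pi> j' \<pi>'
      assume j: "a < j" "\<pi> \<in> interval_partitions_from j n" and j': "a < j'" "\<pi>' \<in> interval_partitions_from j' n"
        and eq: "insert {a..<j} \<pi> = insert {a..<j'} \<pi>'"
      have "{a..<j} = {a..<j'}"
      proof -
        have "{a..<j} \<notin> \<pi>'"
        proof
          assume "{a..<j} \<in> \<pi>'"
          then have "a \<in> {j'..<n}" using fresh(4)[OF j'(2,1)] j(1) by (metis UnionI atLeastLessThan_iff order_refl)
          then show False using j'(1) by simp
        qed
        then show ?thesis using eq by blast
      qed
      then have "j = j'" using j(1) j'(1) by (metis atLeastLessThan_inj(2))
      then show "j = j' \<and> \<pi> = \<pi>'"
        using eq fresh(1)[OF j(2,1)] fresh(1)[OF j'(2,1)] by (metis insert_ident)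
    qed
    show "(\<lambda>(j, \<pi>). insert {a..<j} \<pi>) ` (Sigma {a<..n} (\<lambda>j. interval_partitions_from j n)) = interval_partitions_from a n"
    proof (intro equalityI subsetI)
      fix \<pi> assume "\<pi> \<in> (\<lambda>(j, \<pi>). insert {a..<j} \<pi>) ` (Sigma {a<..n} (\<lambda>j. interval_partitions_from j n))"
      then obtain j \<pi>' where j: "a < j" "j \<le> n" "\<pi>' \<in> interval_partitions_from j n" and \<pi>: "\<pi> = insert {a..<j} \<pi>'" by auto
      have "{a..<n} - {a..<j} = {j..<n}" using j by auto
      then have "partition_on {a..<n} \<pi>"
        unfolding \<pi> using j fresh(3)[OF j(3,1)]
        by (subst partition_on_insert) (auto simp: interval_partitions_from_def)
      then show "\<pi> \<in> interval_partitions_from a n" using j unfolding \<pi> interval_partitions_from_def by blast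
    next
      fix \<pi> assume \<pi>: "\<pi> \<in> interval_partitions_from a n"
      then have p: "partition_on {a..<n} \<pi>" by (simp add: interval_partitions_from_def)
      have "a \<in> \<Union>\<pi>" using p \<open>a < n\<close> by (simp add: partition_on_def)
      then obtain B where B: "B \<in> \<pi>" "a \<in> B" by blast
      obtain c j where cj: "B = {c..<j}" using \<pi> B(1) unfolding interval_partitions_from_def by blast
      have sub: "B \<subseteq> {a..<n}" using p B(1) by (auto simp: partition_on_def)
      have "c = a" using sub B(2) unfolding cj by (meson atLeastLessThan_iff atLeastLessThan_subset_iff le_antisym le_less_trans leD order_refl)
      then have Bj: "B = {a..<j}" and "a < j" using cj B(2) by auto
      then have "j \<le> n" using sub by (meson atLeastLessThan_subset_iff leD)
      let ?\<pi>' = "\<pi> - {B}"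
      have ins: "insert {a..<j} ?\<pi>' = \<pi>" using B Bj by blast
      have "disjnt {a..<j} (\<Union>?\<pi>')"
        using p B(1) unfolding Bj[symmetric] partition_on_def disjoint_def disjnt_def by blast
      then have "partition_on ({a..<n} - {a..<j}) ?\<pi>'"
        using p partition_on_insert ins by metis
      moreover have "{a..<n} - {a..<j} = {j..<n}" using \<open>a < j\<close> by auto
      ultimately have "?\<pi>' \<in> interval_partitions_from j n" using \<pi> unfolding interval_partitions_from_def by auto
      then show "\<pi> \<in> (\<lambda>(j, \<pi>). insert {a..<j} \<pi>) ` (Sigma {a<..n} (\<lambda>j. interval_partitions_from j n))"
        using ins \<open>a < j\<close> \<open>j \<le> n\<close> by (intro image_eqI[of _ _ "(j, ?\<pi>')"]) auto
    qed
  qed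
  have "(\<Sum>\<pi>\<in>interval_partitions_from a n. \<Prod>B\<in>\<pi>. f B)
      = (\<Sum>(j, \<pi>)\<in>Sigma {a<..n} (\<lambda>j. interval_partitions_from j n). \<Prod>B\<in>insert {a..<j} \<pi>. f B)"
    by (subst sum.reindex_bij_betw[OF bij, symmetric]) (simp add: case_prod_unfold)
  also have "\<dots> = (\<Sum>(j, \<pi>)\<in>Sigma {a<..n} (\<lambda>j. interval_partitions_from j n). f {a..<j} * (\<Prod>B\<in>\<pi>. f B))"
    by (intro sum.cong refl) (auto simp: fresh)
  also have "\<dots> = (\<Sum>j\<in>{a<..n}. f {a..<j} * (\<Sum>\<pi>\<in>interval_partitions_from j n. \<Prod>B\<in>\<pi>. f B))"
    by (subst sum.Sigma[symmetric]) (simp_all add: fin sum_distrib_left)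
  finally show ?thesis .
qed

lemma interval_partitions_eq_from_0: "interval_partitions n = interval_partitions_from 0 n"
  by (simp add: interval_partitions_def interval_partitions_from_def lessThan_atLeast0)

lemma interval_partitions_from_self: "interval_partitions_from n n = {{}}"
  by (auto simp: interval_partitions_from_def partition_on_empty)

text \<open>\<open>\<pi>(y\<^sub>1 \<pi>(y\<^sub>2 \<dots> \<pi>(y\<^sub>n)))\<close> for the centering \<open>\<pi>(y) = y - \<phi>(y) 1\<close>. The empty product is \<open>1\<close>
  and stays uncentered, being the vector that the recursion starts from.\<close>

primrec centered_prod :: "('a::unital_star_algebra \<Rightarrow> complex) \<Rightarrow> 'a list \<Rightarrow> 'a" where
  "centered_prod \<phi> [] = 1"
| "centered_prod \<phi> (y # ys) = y * centered_prod \<phi> ys - \<phi> (y * centered_prod \<phi> ys) *\<^sub>C 1"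

text \<open>Unfolding \<open>y = \<pi>(y) + \<phi>(y) 1\<close> after each multiplication: the \<open>j\<close>-th term collects the
  scalar split off just in front of \<open>drop j xs\<close>.\<close>

lemma prod_list_eq_sum_centered_prod:
  assumes "is_state \<phi>"
  shows "prod_list xs = (\<Sum>j\<le>length xs. \<phi> (prod_list (drop j xs)) *\<^sub>C centered_prod \<phi> (take j xs))"
proof (induction xs)
  case Nil
  then show ?case by (simp add: state_one[OF assms] scaleC_one)
next
  case (Cons y ys)
  have expand: "y * prod_list ys =
      (\<Sum>j\<le>length ys. \<phi> (prod_list (drop j ys)) *\<^sub>C (y * centered_prod \<phi> (take j ys)))"
    by (subst Cons.IH) (simp add: sum_distrib_left mult_scaleC_right)
  then have "\<phi> (y * prod_list ys) =
      (\<Sum>j\<le>length ys. \<phi> (prod_list (drop j ys)) * \<phi> (y * centered_prod \<phi> (take j ys)))"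
    by (simp add: state_sum[OF assms] state_scaleC[OF assms])
  then show ?case
    by (simp add: sum.atMost_Suc_shift scaleC.scale_right_diff_distrib sum_subtractf
        scaleC.scale_sum_left[symmetric] expand[symmetric] del: sum.atMost_Suc)
qed

text \<open>This is the moment-cumulant recursion over the first block, with \<open>\<phi> (y * centered_prod \<phi> _)\<close>
  in the place of the cumulant.\<close>

lemma moment_first_block:
  assumes "is_state \<phi>"
  shows "\<phi> (y * prod_list ys) =
    (\<Sum>j\<le>length ys. \<phi> (y * centered_prod \<phi> (take j ys)) * \<phi> (prod_list (drop j ys)))"
  by (subst prod_list_eq_sum_centered_prod[OF assms])
     (simp add: sum_distrib_left mult_scaleC_right state_sum[OF assms] state_scaleC[OF assms] mult.commute)

lemma nths_atLeastLessThan: "nths xs {a..<b} = take (b - a) (drop a xs)"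
proof (cases "a \<le> length xs")
  case True
  have "{j. j + a \<in> {a..<b}} = {..<b - a}" by auto
  moreover have "nths (take a xs) {a..<b} = []"
    using in_set_nthsD by (auto simp: nths_def filter_empty_conv in_set_zip)
  ultimately show ?thesis
    using True nths_append[of "take a xs" "drop a xs" "{a..<b}"] by (simp add: min_absorb2)
next
  case False
  then show ?thesis by (auto simp: nths_def filter_empty_conv in_set_zip)
qed

text \<open>Both sides solve the moment-cumulant formula: for the right-hand side this follows from
  \<open>moment_first_block\<close>, one block at a time. The formula determines its solution by recursion on
  the length.\<close>

lemma boolean_cumulant_Cons:
  assumes "is_state \<phi>"
  shows "boolean_cumulant \<phi> (x # xs) = \<phi> (x * centered_prod \<phi> xs)"
proof -
  define k where "k ys = \<phi> (hd ys * centered_prod \<phi> (tl ys))" for ys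
  \<comment> \<open>Letting the start \<open>a\<close> vary makes the statement for the remaining blocks an induction hypothesis.\<close>
  have moment: "(\<Sum>\<pi>\<in>interval_partitions_from a (length ys). \<Prod>B\<in>\<pi>. k (nths ys B))
      = \<phi> (prod_list (drop a ys))" if "a \<le> length ys" for a ys
    using that
  proof (induction "length ys - a" arbitrary: a rule: less_induct)
    case less
    show ?case
    proof (cases "a = length ys")
      case True
      then show ?thesis by (simp add: interval_partitions_from_self state_one[OF assms])
    next
      case False
      then have "a < length ys" using less.prems by simp
      then obtain z zs where zs: "drop a ys = z # zs"
        by (cases "drop a ys") auto
      have len: "length ys = Suc (a + length zs)"
        using arg_cong[OF zs, of length] \<open>a < length ys\<close> by simp
      have "(\<Sum>\<pi>\<in>interval_partitions_from a (length ys). \<Prod>B\<in>\<pi>. k (nths ys B))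
          = (\<Sum>j\<in>{a<..length ys}. k (take (j - a) (z # zs)) * \<phi> (prod_list (drop j ys)))"
        unfolding sum_interval_partitions_first_block[OF \<open>a < length ys\<close>] nths_atLeastLessThan zs
        using less.prems by (intro sum.cong refl arg_cong2[where f = "(*)"] less.hyps) auto
      also have "\<dots> = (\<Sum>j\<le>length zs. k (take (Suc j) (z # zs)) * \<phi> (prod_list (drop j zs)))"
      proof (rule sum.reindex_bij_witness[where i = "\<lambda>j. Suc (a + j)" and j = "\<lambda>j. j - Suc a"])
        fix j assume j: "j \<in> {a<..length ys}"
        then have "drop j ys = drop (Suc (j - Suc a)) (drop a ys)" by simp
        then have "drop j ys = drop (j - Suc a) zs" by (simp add: zs)
        then show "k (take (Suc (j - Suc a)) (z # zs)) * \<phi> (prod_list (drop (j - Suc a) zs))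
            = k (take (j - a) (z # zs)) * \<phi> (prod_list (drop j ys))"
          using j by (simp add: Suc_diff_Suc del: take_Suc_Cons)
      qed (auto simp: len)
      also have "\<dots> = \<phi> (z * prod_list zs)"
        by (simp add: k_def moment_first_block[OF assms])
      finally show ?thesis by (simp add: zs)
    qed
  qed
  have "boolean_cumulant \<phi> ys = k ys" if "ys \<noteq> []" for ys
    using that
  proof (induction "length ys" arbitrary: ys rule: less_induct)
    case less
    let ?n = "length ys" and ?trivial = "{{..<length ys}}"
    have block: "boolean_cumulant \<phi> (nths ys B) = k (nths ys B)"
      if \<pi>: "\<pi> \<in> interval_partitions ?n - {?trivial}" and B: "B \<in> \<pi>" for \<pi> B
    proof -
      have sub: "B \<subset> {..<?n}" using \<pi> B by (rule interval_partitions_block_small)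
      then have eq: "{i. i < ?n \<and> i \<in> B} = B" by auto
      have "B \<noteq> {}" using \<pi> B by (auto simp: interval_partitions_def partition_on_def)
      then have "0 < length (nths ys B)"
        using sub finite_subset[of B "{..<?n}"] by (simp add: length_nths eq card_gt_0_iff)
      moreover have "length (nths ys B) < ?n"
        using psubset_card_mono[OF _ sub] by (simp add: length_nths eq)
      ultimately show ?thesis by (intro less.hyps) auto
    qed
    have "partition_on {..<?n} ?trivial"
      using less.prems by (intro partition_on_space) auto
    moreover have "\<exists>a b. {..<?n} = {a..<b}" by (metis lessThan_atLeast0)
    ultimately have "?trivial \<in> interval_partitions ?n" by (simp add: interval_partitions_def)
    moreover have "nths ys {..<?n} = ys" by (simp add: nths_upt_eq_take)
    ultimately have "\<phi> (prod_list ys)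
        = k ys + (\<Sum>\<pi>\<in>interval_partitions ?n - {?trivial}. \<Prod>B\<in>\<pi>. k (nths ys B))"
      using moment[of 0 ys] sum.remove[OF finite_interval_partitions, of ?trivial ?n "\<lambda>\<pi>. \<Prod>B\<in>\<pi>. k (nths ys B)"]
      by (simp add: interval_partitions_eq_from_0)
    then show ?case
      by (simp add: boolean_cumulant.simps[of \<phi> ys] block)
  qed
  from this[of "x # xs"] show ?thesis by (simp add: k_def)
qed

section \<open>Boolean independent copies acting modulo undetectable elements\<close>

locale boolean_iid =
  fixes \<phi> :: "'a::unital_star_algebra \<Rightarrow> complex" and I :: "'i set" and X :: "'i \<Rightarrow> 'a"
    and \<kappa> :: "nat \<Rightarrow> complex"
  assumes state: "is_state \<phi>" and finite_I: "finite I" and indep: "boolean_indep \<phi> I X"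
    and cumulants: "\<And>a m. a \<in> I \<Longrightarrow> 1 \<le> m \<Longrightarrow> boolean_cumulant1 \<phi> m (X a) = \<kappa> m"
begin

lemmas state_simps = state_add[OF state] state_scaleC[OF state] state_one[OF state]
  state_zero[OF state] state_diff[OF state] state_sum[OF state]

text \<open>For self-adjoint \<open>X\<^sub>a\<close> this is equality of vectors in the GNS representation up to the
  orthogonal complement of those that the \<open>X\<^sub>a\<close> generate from the vacuum.\<close>

definition word_equiv :: "'a \<Rightarrow> 'a \<Rightarrow> bool" (infix "\<approx>" 50) where
  "y \<approx> z \<longleftrightarrow> (\<forall>w\<in>lists I. \<phi> (prod_list (map X w) * y) = \<phi> (prod_list (map X w) * z))"

lemma word_equiv_refl [simp, intro]: "y \<approx> y"
  by (simp add: word_equiv_def)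

lemma word_equiv_trans [trans]: "y \<approx> z \<Longrightarrow> z \<approx> v \<Longrightarrow> y \<approx> v"
  by (simp add: word_equiv_def)

lemma word_equiv_add: "y \<approx> z \<Longrightarrow> y' \<approx> z' \<Longrightarrow> y + y' \<approx> z + z'"
  by (simp add: word_equiv_def distrib_left state_simps)

lemma word_equiv_scaleC: "y \<approx> z \<Longrightarrow> c *\<^sub>C y \<approx> c *\<^sub>C z"
  by (simp add: word_equiv_def mult_scaleC_right state_simps)

lemma word_equiv_sum: "(\<And>i. i \<in> A \<Longrightarrow> f i \<approx> g i) \<Longrightarrow> (\<Sum>i\<in>A. f i) \<approx> (\<Sum>i\<in>A. g i)"
  by (simp add: word_equiv_def sum_distrib_left state_simps)

lemma word_equiv_state: "y \<approx> z \<Longrightarrow> \<phi> y = \<phi> z"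
  unfolding word_equiv_def by (drule bspec[of _ _ "[]"]) auto

lemma word_equiv_mult_left: "y \<approx> z \<Longrightarrow> a \<in> I \<Longrightarrow> X a * y \<approx> X a * z"
  unfolding word_equiv_def
proof
  fix w assume "\<forall>w\<in>lists I. \<phi> (prod_list (map X w) * y) = \<phi> (prod_list (map X w) * z)"
    and "a \<in> I" "w \<in> lists I"
  then show "\<phi> (prod_list (map X w) * (X a * y)) = \<phi> (prod_list (map X w) * (X a * z))"
    by (auto dest!: bspec[of _ _ "w @ [a]"] simp: mult.assoc)
qed

text \<open>Boolean independence applies to products with distinct neighbours, so equal adjacent letters
  are merged. The last letter is recorded because it decides whether the product may be
  continued by an element of a given subalgebra.\<close>

lemma word_as_alternating_product:
  assumes "w \<noteq> []" "w \<in> lists I"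
  shows "\<exists>ps. ps \<noteq> [] \<and> distinct_adj (map fst ps) \<and>
    (\<forall>(a, y)\<in>set ps. a \<in> I \<and> y \<in> generated_subalgebra {X a}) \<and>
    prod_list (map snd ps) = prod_list (map X w) \<and> fst (last ps) = last w"
  using assms
proof (induction w rule: list_nonempty_induct)
  case (single a)
  then show ?case
    by (intro exI[of _ "[(a, X a)]"]) (auto intro: generated_subalgebra.generator)
next
  case (cons a w)
  then obtain ps where ps: "ps \<noteq> []" "distinct_adj (map fst ps)"
      "\<forall>(a, y)\<in>set ps. a \<in> I \<and> y \<in> generated_subalgebra {X a}"
      "prod_list (map snd ps) = prod_list (map X w)" "fst (last ps) = last w"
    by auto
  obtain b y qs where qs: "ps = (b, y) # qs" using ps(1) by (cases ps) auto
  have gen: "X a \<in> generated_subalgebra {X a}" by (simp add: generated_subalgebra.generator)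
  show ?case
  proof (cases "a = b")
    case True
    then show ?thesis using ps cons qs gen
      by (intro exI[of _ "(a, X a * y) # qs"])
         (auto simp: mult.assoc distinct_adj_Cons intro: generated_subalgebra.mult)
  next
    case False
    then show ?thesis using ps cons qs gen
      by (intro exI[of _ "(a, X a) # ps"]) (auto simp: distinct_adj_Cons)
  qed
qed

lemma state_alternating_product:
  assumes "distinct_adj (map fst ps)"
    and "\<forall>(a, y)\<in>set ps. a \<in> I \<and> y \<in> generated_subalgebra {X a}"
  shows "\<phi> (prod_list (map snd ps)) = prod_list (map (\<lambda>p. \<phi> (snd p)) ps)"
proof -
  have "\<phi> (prod_list (map (\<lambda>j. snd (ps ! j)) [0..<length ps])) = (\<Prod>j<length ps. \<phi> (snd (ps ! j)))"
    using indep[unfolded boolean_indep_def boolean_indep_subalgebras_def,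
        rule_format, of "length ps" "\<lambda>j. fst (ps ! j)" "\<lambda>j. snd (ps ! j)"] assms
    by (fastforce simp: distinct_adj_conv_nth dest: nth_mem)
  moreover have "map (\<lambda>j. snd (ps ! j)) [0..<length ps] = map snd ps"
    by (rule nth_equalityI) auto
  ultimately show ?thesis
    by (simp add: prod.list_conv_set_nth lessThan_atLeast0)
qed

lemma state_word_mult:
  assumes "w \<in> lists I" "w \<noteq> []" "a \<in> I" "last w \<noteq> a" "y \<in> generated_subalgebra {X a}"
  shows "\<phi> (prod_list (map X w) * y) = \<phi> (prod_list (map X w)) * \<phi> y"
proof -
  obtain ps where ps: "ps \<noteq> []" "distinct_adj (map fst ps)"
      "\<forall>(a, y)\<in>set ps. a \<in> I \<and> y \<in> generated_subalgebra {X a}"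
      "prod_list (map snd ps) = prod_list (map X w)" "fst (last ps) = last w"
    using word_as_alternating_product[OF assms(2,1)] by blast
  have "distinct_adj (map fst (ps @ [(a, y)]))"
    using ps assms(4) by (simp add: distinct_adj_append_iff last_map)
  then have "\<phi> (prod_list (map snd (ps @ [(a, y)]))) = prod_list (map (\<lambda>p. \<phi> (snd p)) (ps @ [(a, y)]))"
    using ps(3) assms(3,5) by (intro state_alternating_product) auto
  with state_alternating_product[OF ps(2,3)] show ?thesis by (simp add: ps(4))
qed

text \<open>Picture the variables acting on a vacuum vector and one orthogonal summand for each index:
  \<open>U a 0\<close> is the vacuum, and \<open>U a m\<close> with \<open>m > 0\<close> lies in the summand of \<open>a\<close>.\<close>

abbreviation U :: "'i \<Rightarrow> nat \<Rightarrow> 'a" where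
  "U a m \<equiv> centered_prod \<phi> (replicate m (X a))"

lemma state_mult_U: "a \<in> I \<Longrightarrow> \<phi> (X a * U a m) = \<kappa> (Suc m)"
  using cumulants[of a "Suc m"] boolean_cumulant_Cons[OF state, of "X a" "replicate m (X a)"]
  by (simp add: boolean_cumulant1_def)

lemma mult_U: "a \<in> I \<Longrightarrow> X a * U a m = U a (Suc m) + \<kappa> (Suc m) *\<^sub>C 1"
  by (simp add: state_mult_U)

lemma state_U: "\<phi> (U a (Suc m)) = 0"
  by (simp add: state_simps)

text \<open>The generated algebra lacks the unit, so \<open>U a m\<close> itself need not belong to it; multiplying by
  \<open>X a\<close> absorbs the multiples of \<open>1\<close> that centering introduces.\<close>

lemma mult_U_in_subalgebra: "X a * U a m \<in> generated_subalgebra {X a}"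
proof (induction m)
  case 0
  then show ?case by (simp add: generated_subalgebra.generator)
next
  case (Suc m)
  let ?y = "X a * U a m"
  have "X a * U a (Suc m) = X a * ?y + (- \<phi> ?y) *\<^sub>C X a"
    by (simp add: right_diff_distrib mult_scaleC_right)
  then show ?case
    using Suc by (metis generated_subalgebra.intros(1,3-5) singletonI)
qed

text \<open>The heart of Boolean independence: after a word that ends in \<open>X b\<close>, an element \<open>y\<close> of the algebra of
  \<open>X a\<close> acts as the scalar \<open>\<phi> y\<close>, and so its centering acts as zero.\<close>

lemma mult_U_other:
  assumes "a \<in> I" "b \<in> I" "b \<noteq> a"
  shows "X b * U a (Suc m) \<approx> 0"
  unfolding word_equiv_def
proof
  fix w assume "w \<in> lists I"
  let ?y = "X a * U a m"
  have "\<phi> (prod_list (map X (w @ [b])) * ?y) = \<phi> (prod_list (map X (w @ [b]))) * \<phi> ?y"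
    using assms \<open>w \<in> lists I\<close> mult_U_in_subalgebra by (intro state_word_mult) auto
  then show "\<phi> (prod_list (map X w) * (X b * U a (Suc m))) = \<phi> (prod_list (map X w) * 0)"
    by (simp add: right_diff_distrib mult_scaleC_right state_simps mult.assoc mult.commute)
qed

text \<open>The case distinction is needed because the summands share the vacuum: at \<open>m = 0\<close> the sum would
  count it once for every \<open>a\<close>.\<close>

definition W :: "nat \<Rightarrow> 'a" where
  "W m = (if m = 0 then 1 else \<Sum>a\<in>I. U a m)"

abbreviation S :: 'a where "S \<equiv> \<Sum>a\<in>I. X a"
abbreviation Q :: 'a where "Q \<equiv> \<Sum>a\<in>I. (X a)\<^sup>2"
abbreviation N :: complex where "N \<equiv> of_nat (card I)"

lemma state_W: "\<phi> (W (Suc m)) = 0"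
  by (simp add: W_def state_simps(6) state_U del: centered_prod.simps replicate_Suc)

text \<open>Of all summands of \<open>W m\<close>, only the one with index \<open>a\<close> survives multiplication by \<open>X a\<close>. This
  covers \<open>m = 0\<close> as well, where \<open>W 0\<close> is the common vacuum.\<close>

lemma mult_W:
  assumes "a \<in> I"
  shows "X a * W m \<approx> U a (Suc m) + \<kappa> (Suc m) *\<^sub>C 1"
proof (cases m)
  case 0
  then show ?thesis using mult_U[OF assms, of 0] by (simp add: W_def)
next
  case (Suc k)
  have "X a * W m = X a * U a m + (\<Sum>b\<in>I-{a}. X a * U b m)"
    by (simp add: W_def Suc sum.remove[OF finite_I assms] distrib_left sum_distrib_left del: centered_prod.simps replicate_Suc)
  also have "\<dots> \<approx> X a * U a m + (\<Sum>b\<in>I-{a}. 0)"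
    unfolding Suc using assms by (intro word_equiv_add word_equiv_refl word_equiv_sum mult_U_other) auto
  finally show ?thesis
    using mult_U[OF assms, of m] by (simp del: centered_prod.simps replicate_Suc)
qed

lemma S_mult_W: "S * W m \<approx> W (Suc m) + (N * \<kappa> (Suc m)) *\<^sub>C 1"
proof -
  have "S * W m \<approx> (\<Sum>a\<in>I. U a (Suc m) + \<kappa> (Suc m) *\<^sub>C 1)"
    unfolding sum_distrib_right by (intro word_equiv_sum mult_W)
  also have "\<dots> = W (Suc m) + (N * \<kappa> (Suc m)) *\<^sub>C 1"
    by (simp add: W_def sum.distrib sum_constant_scaleC del: sum_constant centered_prod.simps replicate_Suc)
  finally show ?thesis .
qed

lemma word_equiv_S_mult: "y \<approx> z \<Longrightarrow> S * y \<approx> S * z"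
  unfolding sum_distrib_right by (intro word_equiv_sum word_equiv_mult_left)

lemma S_squared_mult_W:
  "S\<^sup>2 * W m \<approx> (W (m + 2) + (N * \<kappa> (m + 2)) *\<^sub>C 1) + (N * \<kappa> (Suc m)) *\<^sub>C S"
proof -
  have "S\<^sup>2 * W m = S * (S * W m)"
    by (simp add: power2_eq_square mult.assoc)
  also have "\<dots> \<approx> S * (W (Suc m) + (N * \<kappa> (Suc m)) *\<^sub>C 1)"
    by (rule word_equiv_S_mult[OF S_mult_W])
  also have "\<dots> = S * W (Suc m) + (N * \<kappa> (Suc m)) *\<^sub>C S"
    by (simp add: distrib_left mult_scaleC_right)
  also have "\<dots> \<approx> (W (m + 2) + (N * \<kappa> (m + 2)) *\<^sub>C 1) + (N * \<kappa> (Suc m)) *\<^sub>C S"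
    using S_mult_W[of "Suc m"] by (intro word_equiv_add word_equiv_refl) simp
  finally show ?thesis .
qed

lemma Q_mult_W:
  "Q * W m \<approx> (W (m + 2) + (N * \<kappa> (m + 2)) *\<^sub>C 1) + \<kappa> (Suc m) *\<^sub>C S"
proof -
  have "(X a)\<^sup>2 * W m \<approx> (U a (m + 2) + \<kappa> (m + 2) *\<^sub>C 1) + \<kappa> (Suc m) *\<^sub>C X a" if "a \<in> I" for a
  proof -
    have "(X a)\<^sup>2 * W m = X a * (X a * W m)"
      by (simp add: power2_eq_square mult.assoc)
    also have "\<dots> \<approx> X a * (U a (Suc m) + \<kappa> (Suc m) *\<^sub>C 1)"
      using that by (intro word_equiv_mult_left mult_W)
    also have "\<dots> = X a * U a (Suc m) + \<kappa> (Suc m) *\<^sub>C X a"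
      by (simp only: distrib_left mult_scaleC_right mult_1_right)
    also have "X a * U a (Suc m) = U a (m + 2) + \<kappa> (m + 2) *\<^sub>C 1"
      using mult_U[OF that, of "Suc m"] by (simp only: add_2_eq_Suc')
    finally show ?thesis .
  qed
  then have "Q * W m \<approx> (\<Sum>a\<in>I. (U a (m + 2) + \<kappa> (m + 2) *\<^sub>C 1) + \<kappa> (Suc m) *\<^sub>C X a)"
    unfolding sum_distrib_right by (intro word_equiv_sum)
  also have "\<dots> = (W (m + 2) + (N * \<kappa> (m + 2)) *\<^sub>C 1) + \<kappa> (Suc m) *\<^sub>C S"
    by (simp add: W_def sum.distrib sum_constant_scaleC scaleC.scale_sum_right del: sum_constant centered_prod.simps replicate_Suc)
  finally show ?thesis .
qed

text \<open>The forms \<open>Q\<close> and \<open>S\<^sup>2\<close> act on \<open>W m\<close> alike except for the multiple of \<open>S\<close>, where the factor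
  is \<open>1\<close> for \<open>Q\<close> and the number of variables for \<open>S\<^sup>2\<close>. The combined factor is the row sum of the
  coefficient matrix.\<close>

lemma quadratic_form_mult_W:
  assumes "(e + N * d) * \<kappa> (Suc m) = 0"
  shows "(e *\<^sub>C Q + d *\<^sub>C S\<^sup>2) * W m \<approx> (e + d) *\<^sub>C (W (m + 2) + (N * \<kappa> (m + 2)) *\<^sub>C 1)"
proof -
  let ?V = "W (m + 2) + (N * \<kappa> (m + 2)) *\<^sub>C 1"
  have regroup: "e *\<^sub>C (v + k *\<^sub>C z) + d *\<^sub>C (v + (N * k) *\<^sub>C z)
      = (e + d) *\<^sub>C v + ((e + N * d) * k) *\<^sub>C z" for v z :: 'a and k
    by (simp add: scaleC_add_right scaleC_add_left distrib_right)
  have "(e *\<^sub>C Q + d *\<^sub>C S\<^sup>2) * W m = e *\<^sub>C (Q * W m) + d *\<^sub>C (S\<^sup>2 * W m)"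
    by (simp only: distrib_right mult_scaleC_left)
  also have "\<dots> \<approx> e *\<^sub>C (?V + \<kappa> (Suc m) *\<^sub>C S) + d *\<^sub>C (?V + (N * \<kappa> (Suc m)) *\<^sub>C S)"
    by (intro word_equiv_add word_equiv_scaleC Q_mult_W S_squared_mult_W)
  also have "\<dots> = (e + d) *\<^sub>C ?V + ((e + N * d) * \<kappa> (Suc m)) *\<^sub>C S"
    by (rule regroup)
  finally show ?thesis by (simp add: assms)
qed

text \<open>Starting from \<open>W 0 = 1\<close>, only even indices occur, and the obstruction at \<open>W (2 * k)\<close> is a
  cumulant of odd order \<open>2 * k + 1\<close>. Each step contributes the diagonal coefficient \<open>e + d\<close>; the
  final factor \<open>N\<close> counts the summands of \<open>W\<close>.\<close>

theorem cumulant_symmetric_quadratic_form: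
  assumes odd: "\<And>m. odd m \<Longrightarrow> (e + N * d) * \<kappa> m = 0" and "1 \<le> r"
  shows "boolean_cumulant1 \<phi> r (e *\<^sub>C Q + d *\<^sub>C S\<^sup>2) = N * (e + d) ^ r * \<kappa> (2 * r)"
proof -
  let ?P = "e *\<^sub>C Q + d *\<^sub>C S\<^sup>2"
  have P_mult: "?P * y \<approx> ?P * z" if "y \<approx> z" for y z
  proof -
    have "Q * y \<approx> Q * z"
      unfolding sum_distrib_right power2_eq_square mult.assoc
      using that by (intro word_equiv_sum word_equiv_mult_left)
    moreover have "S\<^sup>2 * y \<approx> S\<^sup>2 * z"
      unfolding power2_eq_square mult.assoc using that by (intro word_equiv_S_mult)
    ultimately show ?thesis
      unfolding distrib_right mult_scaleC_left by (intro word_equiv_add word_equiv_scaleC)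
  qed
  have step: "?P * y \<approx> c *\<^sub>C ((e + d) *\<^sub>C (W (2 * k + 2) + (N * \<kappa> (2 * k + 2)) *\<^sub>C 1))"
    if "y \<approx> c *\<^sub>C W (2 * k)" for y c k
    using word_equiv_trans[OF P_mult[OF that], of "c *\<^sub>C ((e + d) *\<^sub>C (W (2 * k + 2) + (N * \<kappa> (2 * k + 2)) *\<^sub>C 1))"]
      word_equiv_scaleC[OF quadratic_form_mult_W[OF odd, of "2 * k"]]
    by (simp only: mult_scaleC_right) simp
  have state_step: "\<phi> (?P * y) = c * (e + d) * N * \<kappa> (2 * k + 2)"
    if "y \<approx> c *\<^sub>C W (2 * k)" for y c k
    using word_equiv_state[OF step[OF that]] state_W[of "Suc (2 * k)"]
    by (simp add: state_simps)
  have iterate: "centered_prod \<phi> (replicate k ?P) \<approx> (e + d) ^ k *\<^sub>C W (2 * k)" for k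
  proof (induction k)
    case 0
    then show ?case by (simp add: W_def)
  next
    case (Suc k)
    let ?y = "centered_prod \<phi> (replicate k ?P)"
    define v where "v = \<phi> (?P * ?y)"
    have v: "v = (e + d) ^ k * (e + d) * N * \<kappa> (2 * k + 2)"
      unfolding v_def by (rule state_step[OF Suc.IH])
    have "?P * ?y + (- v) *\<^sub>C 1
        \<approx> (e + d) ^ k *\<^sub>C ((e + d) *\<^sub>C (W (2 * k + 2) + (N * \<kappa> (2 * k + 2)) *\<^sub>C 1)) + (- v) *\<^sub>C 1"
      by (intro word_equiv_add step Suc.IH word_equiv_refl)
    also have "\<dots> = (e + d) ^ Suc k *\<^sub>C W (2 * Suc k)"
      unfolding v by (simp add: scaleC_add_right mult_ac)
    finally show ?case by (simp add: v_def)
  qed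
  obtain k where r: "r = Suc k" using \<open>1 \<le> r\<close> by (cases r) auto
  then show ?thesis
    using state_step[OF iterate[of k]] boolean_cumulant_Cons[OF state, of ?P "replicate k ?P"]
    by (simp add: boolean_cumulant1_def algebra_simps)
qed

end

section \<open>Reduction of the quadratic forms\<close>

text \<open>Precomposing with a transposition shows that the sum does not depend on \<open>i\<close>, and summing
  over \<open>i\<close> first gives the sum over \<open>A\<close> for every single permutation.\<close>

lemma sum_permutes_apply:
  fixes f :: "'i \<Rightarrow> 'a::unital_star_algebra"
  assumes "finite A" "i \<in> A"
  shows "(\<Sum>\<sigma> | \<sigma> permutes A. f (\<sigma> i)) = fact (card A - 1) *\<^sub>C (\<Sum>a\<in>A. f a)"
proof -
  let ?n = "of_nat (card A) :: complex"
  have same: "(\<Sum>\<sigma> | \<sigma> permutes A. f (\<sigma> j)) = (\<Sum>\<sigma> | \<sigma> permutes A. f (\<sigma> i))" if "j \<in> A" for j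
    using sum_permutations_compose_right[of "Transposition.transpose i j" A "\<lambda>\<sigma>. f (\<sigma> i)"]
      that assms by (simp add: permutes_swap_id)
  have "?n *\<^sub>C (\<Sum>\<sigma> | \<sigma> permutes A. f (\<sigma> i)) = (\<Sum>j\<in>A. \<Sum>\<sigma> | \<sigma> permutes A. f (\<sigma> j))"
    unfolding sum_constant_scaleC[symmetric] by (rule sum.cong[OF refl], rule same[symmetric])
  also have "\<dots> = (\<Sum>\<sigma> | \<sigma> permutes A. \<Sum>j\<in>A. f (\<sigma> j))"
    by (rule sum.swap)
  also have "\<dots> = (\<Sum>\<sigma> | \<sigma> permutes A. \<Sum>a\<in>A. f a)"
    by (intro sum.cong refl sum.reindex_bij_betw) (simp add: permutes_imp_bij)
  also have "\<dots> = fact (card A) *\<^sub>C (\<Sum>a\<in>A. f a)"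
    by (simp add: sum_constant_scaleC card_permutations[OF refl assms(1)] del: sum_constant)
  also have "\<dots> = ?n *\<^sub>C (fact (card A - 1) *\<^sub>C (\<Sum>a\<in>A. f a))"
    using assms by (subst fact_reduce) (auto simp: card_gt_0_iff)
  finally show ?thesis
    by (rule scaleC.scale_left_imp_eq[rotated]) (use assms in auto)
qed

text \<open>Symmetrising in the second index \<open>j \<noteq> i\<close> in the same way reduces the pair to its first index.\<close>

lemma sum_permutes_apply_pair:
  fixes f :: "'i \<Rightarrow> 'i \<Rightarrow> 'a::unital_star_algebra"
  assumes "finite A" "i \<in> A" "j \<in> A" "i \<noteq> j"
  shows "(\<Sum>\<sigma> | \<sigma> permutes A. f (\<sigma> i) (\<sigma> j))
    = fact (card A - 2) *\<^sub>C (\<Sum>a\<in>A. \<Sum>b\<in>A-{a}. f a b)"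
proof -
  let ?n = "of_nat (card A - 1) :: complex"
  have pos: "card A - 1 > 0"
    using assms card_mono[of A "{i, j}"] by auto
  have same: "(\<Sum>\<sigma> | \<sigma> permutes A. f (\<sigma> i) (\<sigma> k)) = (\<Sum>\<sigma> | \<sigma> permutes A. f (\<sigma> i) (\<sigma> j))"
    if "k \<in> A - {i}" for k
  proof -
    have "Transposition.transpose j k i = i" "Transposition.transpose j k permutes A"
      using that assms by (auto simp: transpose_apply_other permutes_swap_id)
    then show ?thesis
      using sum_permutations_compose_right[of "Transposition.transpose j k" A "\<lambda>\<sigma>. f (\<sigma> i) (\<sigma> j)"]
      by simp
  qed
  have "?n = of_nat (card (A - {i}))" using assms by simp
  then have "?n *\<^sub>C (\<Sum>\<sigma> | \<sigma> permutes A. f (\<sigma> i) (\<sigma> j)) = (\<Sum>k\<in>A-{i}. \<Sum>\<sigma> | \<sigma> permutes A. f (\<sigma> i) (\<sigma> k))"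
    by (simp only: sum_constant_scaleC[symmetric]) (rule sum.cong[OF refl], rule same[symmetric])
  also have "\<dots> = (\<Sum>\<sigma> | \<sigma> permutes A. \<Sum>k\<in>A-{i}. f (\<sigma> i) (\<sigma> k))"
    by (rule sum.swap)
  also have "\<dots> = (\<Sum>\<sigma> | \<sigma> permutes A. \<Sum>b\<in>A-{\<sigma> i}. f (\<sigma> i) b)"
  proof (rule sum.cong[OF refl], rule sum.reindex_bij_betw)
    fix \<sigma> assume "\<sigma> \<in> {\<sigma>. \<sigma> permutes A}"
    then have \<sigma>: "inj_on \<sigma> A" "\<sigma> ` A = A" by (auto simp: permutes_inj_on permutes_image)
    have "\<sigma> ` (A - {i}) = \<sigma> ` A - \<sigma> ` {i}"
      using assms(2) by (intro inj_on_image_set_diff[OF \<sigma>(1)]) auto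
    then show "bij_betw \<sigma> (A - {i}) (A - {\<sigma> i})"
      using \<sigma> by (auto simp: bij_betw_def intro: inj_on_subset)
  qed
  also have "\<dots> = fact (card A - 1) *\<^sub>C (\<Sum>a\<in>A. \<Sum>b\<in>A-{a}. f a b)"
    using assms by (intro sum_permutes_apply)
  also have "\<dots> = ?n *\<^sub>C (fact (card A - 2) *\<^sub>C (\<Sum>a\<in>A. \<Sum>b\<in>A-{a}. f a b))"
    using pos by (subst fact_reduce) (auto simp: numeral_2_eq_2)
  finally show ?thesis
    by (rule scaleC.scale_left_imp_eq[rotated]) (use pos in auto)
qed

lemma sum_scaleC_squared:
  fixes X :: "'i \<Rightarrow> 'a::unital_star_algebra"
  shows "(\<Sum>i\<in>A. c i *\<^sub>C X i)\<^sup>2 = (\<Sum>i\<in>A. \<Sum>j\<in>A. (c i * c j) *\<^sub>C (X i * X j))"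
  by (simp add: power2_eq_square sum_product mult_scaleC_left mult_scaleC_right scaleC_scaleC mult.commute)

text \<open>With \<open>n = card A\<close>, summing \<open>X (\<sigma> i) * X (\<sigma> j)\<close> over \<open>\<sigma>\<close> gives \<open>(n - 1)! Q\<close> if \<open>i = j\<close>, and
  \<open>(n - 2)! (S\<^sup>2 - Q)\<close> otherwise; here \<open>Q\<close> is the sum of the squares and \<open>S\<close> that of the \<open>X\<^sub>a\<close>. For
  \<open>n \<le> 1\<close> there are no off-diagonal terms; then \<open>d\<close> is zero through its second factor, whatever the
  value of the factorial at the truncated difference.\<close>

lemma sum_permuted_squares:
  fixes X :: "'i \<Rightarrow> 'a::unital_star_algebra" and c :: "'i \<Rightarrow> complex"
  assumes "finite A"
  defines "q \<equiv> \<Sum>i\<in>A. (c i)\<^sup>2"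
  defines "d \<equiv> fact (card A - 2) * ((\<Sum>i\<in>A. c i)\<^sup>2 - q)"
  shows "(\<Sum>\<sigma> | \<sigma> permutes A. (\<Sum>i\<in>A. c i *\<^sub>C X (\<sigma> i))\<^sup>2)
    = (fact (card A - 1) * q - d) *\<^sub>C (\<Sum>a\<in>A. (X a)\<^sup>2) + d *\<^sub>C (\<Sum>a\<in>A. X a)\<^sup>2"
proof -
  let ?Q = "\<Sum>a\<in>A. (X a)\<^sup>2" and ?S = "\<Sum>a\<in>A. X a"
  have off_diagonal: "(\<Sum>a\<in>A. \<Sum>b\<in>A-{a}. f a b) = (\<Sum>a\<in>A. \<Sum>b\<in>A. f a b) - (\<Sum>a\<in>A. f a a)"
    for f :: "'i \<Rightarrow> 'i \<Rightarrow> 'b::ab_group_add"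
    by (simp add: sum_diff1 assms(1) sum_subtractf)
  have pair: "(\<Sum>\<sigma> | \<sigma> permutes A. X (\<sigma> i) * X (\<sigma> j)) = fact (card A - 2) *\<^sub>C (?S\<^sup>2 - ?Q)"
    if "i \<in> A" "j \<in> A - {i}" for i j
    using sum_permutes_apply_pair[of A i j "\<lambda>a b. X a * X b"] that assms(1)
    by (auto simp: off_diagonal power2_eq_square sum_product)
  have diag: "(\<Sum>\<sigma> | \<sigma> permutes A. X (\<sigma> i) * X (\<sigma> i)) = fact (card A - 1) *\<^sub>C ?Q"
    if "i \<in> A" for i
    using sum_permutes_apply[of A i "\<lambda>a. X a * X a"] that assms(1) by (simp add: power2_eq_square)
  have "(\<Sum>\<sigma> | \<sigma> permutes A. (\<Sum>i\<in>A. c i *\<^sub>C X (\<sigma> i))\<^sup>2)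
      = (\<Sum>i\<in>A. \<Sum>j\<in>A. \<Sum>\<sigma> | \<sigma> permutes A. (c i * c j) *\<^sub>C (X (\<sigma> i) * X (\<sigma> j)))"
    unfolding sum_scaleC_squared by (subst sum.swap, rule sum.cong[OF refl], rule sum.swap)
  also have "\<dots> = (\<Sum>i\<in>A. \<Sum>j\<in>A. (c i * c j) *\<^sub>C (\<Sum>\<sigma> | \<sigma> permutes A. X (\<sigma> i) * X (\<sigma> j)))"
    by (simp add: scaleC.scale_sum_right)
  also have "\<dots> = (\<Sum>i\<in>A. (c i)\<^sup>2 *\<^sub>C (fact (card A - 1) *\<^sub>C ?Q)
      + (\<Sum>j\<in>A-{i}. c i * c j) *\<^sub>C (fact (card A - 2) *\<^sub>C (?S\<^sup>2 - ?Q)))"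
  proof (intro sum.cong refl)
    fix i assume i: "i \<in> A"
    show "(\<Sum>j\<in>A. (c i * c j) *\<^sub>C (\<Sum>\<sigma> | \<sigma> permutes A. X (\<sigma> i) * X (\<sigma> j)))
        = (c i)\<^sup>2 *\<^sub>C (fact (card A - 1) *\<^sub>C ?Q)
          + (\<Sum>j\<in>A-{i}. c i * c j) *\<^sub>C (fact (card A - 2) *\<^sub>C (?S\<^sup>2 - ?Q))"
      unfolding scaleC.scale_sum_left power2_eq_square[of "c i"]
      using i by (subst sum.remove[OF assms(1) i], intro arg_cong2[where f = "(+)"] sum.cong refl) (simp_all only: diag pair)
  qed
  also have "\<dots> = q *\<^sub>C (fact (card A - 1) *\<^sub>C ?Q)
      + ((\<Sum>i\<in>A. c i)\<^sup>2 - q) *\<^sub>C (fact (card A - 2) *\<^sub>C (?S\<^sup>2 - ?Q))"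
  proof -
    have "(\<Sum>i\<in>A. c i)\<^sup>2 - q = (\<Sum>i\<in>A. \<Sum>j\<in>A-{i}. c i * c j)"
      by (simp add: off_diagonal q_def power2_eq_square sum_product)
    then show ?thesis
      by (simp only: q_def sum.distrib scaleC.scale_sum_left)
  qed
  also have "\<dots> = (fact (card A - 1) * q - d) *\<^sub>C ?Q + d *\<^sub>C ?S\<^sup>2"
    by (simp add: d_def scaleC.scale_left_diff_distrib scaleC.scale_right_diff_distrib mult.commute)
  finally show ?thesis .
qed

lemma sample_variance_eq:
  fixes X :: "nat \<Rightarrow> 'a::unital_star_algebra"
  assumes "n \<ge> 1"
  shows "sample_variance n X = 1 *\<^sub>C (\<Sum>i=1..n. (X i)\<^sup>2) + (- 1 / of_nat n) *\<^sub>C (\<Sum>i=1..n. X i)\<^sup>2"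
proof -
  let ?S = "\<Sum>i=1..n. X i" and ?c = "1 / of_nat n :: complex"
  have square_diff: "(y - c *\<^sub>C z)\<^sup>2 = y\<^sup>2 - c *\<^sub>C (y * z) - c *\<^sub>C (z * y) + (c * c) *\<^sub>C z\<^sup>2"
    for y z :: 'a and c
    by (simp add: power2_eq_square left_diff_distrib right_diff_distrib mult_scaleC_left
        mult_scaleC_right scaleC.scale_right_diff_distrib)
  have "sample_variance n X = (\<Sum>i=1..n. (X i)\<^sup>2 - ?c *\<^sub>C (X i * ?S) - ?c *\<^sub>C (?S * X i) + (?c * ?c) *\<^sub>C ?S\<^sup>2)"
    unfolding sample_variance_def sample_mean_def by (intro sum.cong refl square_diff)
  also have "\<dots> = (\<Sum>i=1..n. (X i)\<^sup>2) - ?c *\<^sub>C (\<Sum>i=1..n. X i * ?S)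
      - ?c *\<^sub>C (\<Sum>i=1..n. ?S * X i) + (\<Sum>i=1..n. (?c * ?c) *\<^sub>C ?S\<^sup>2)"
    by (simp only: sum.distrib sum_subtractf scaleC.scale_sum_right)
  also have "(\<Sum>i=1..n. X i * ?S) = ?S\<^sup>2"
    by (simp only: power2_eq_square sum_distrib_right)
  also have "(\<Sum>i=1..n. ?S * X i) = ?S\<^sup>2"
    by (simp only: power2_eq_square sum_distrib_left)
  also have "(\<Sum>i=1..n. (?c * ?c) *\<^sub>C ?S\<^sup>2) = of_nat n *\<^sub>C ((?c * ?c) *\<^sub>C ?S\<^sup>2)"
    by (simp only: sum_constant_scaleC card_atLeastAtMost diff_Suc_1)
  also have "of_nat n *\<^sub>C ((?c * ?c) *\<^sub>C ?S\<^sup>2) = ?c *\<^sub>C ?S\<^sup>2"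
    using assms by (simp only: scaleC_scaleC) simp
  finally show ?thesis by (simp add: scaleC.scale_minus_left)
qed

theorem corollary4p6:
  fixes \<phi> :: "'a::unital_star_algebra \<Rightarrow> complex"
    and \<psi> :: "'b::unital_star_algebra \<Rightarrow> complex"
    and X :: "nat \<Rightarrow> 'a" and x :: 'b and n :: nat
  assumes "is_state \<phi>" and "is_state \<psi>"
    and "n \<ge> 1"
    and "self_adjoint x" and "\<forall>i\<in>{1..n}. self_adjoint (X i)"
    and "boolean_indep \<phi> {1..n} X"
    and "\<forall>i\<in>{1..n}. identically_distributed \<phi> (X i) \<psi> x"
  shows "(\<forall>\<alpha> :: nat \<Rightarrow> real.
            \<phi> (\<Sum>i=1..n. complex_of_real (\<alpha> i) *\<^sub>C X i) = 0 \<longrightarrow>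
            (\<Sum>i=1..n. \<alpha> i) = 0 \<or> (\<forall>m. odd m \<longrightarrow> boolean_cumulant1 \<psi> m x = 0) \<longrightarrow>
            (\<forall>r\<ge>1. boolean_cumulant1 \<phi> r
                     (\<Sum>\<sigma> | \<sigma> permutes {1..n}. (permuted_linear_form n \<alpha> X \<sigma>)\<^sup>2) =
                   of_nat n * (fact (n - 1)) ^ r * (complex_of_real (\<Sum>i=1..n. (\<alpha> i)\<^sup>2)) ^ r
                     * boolean_cumulant1 \<psi> (2 * r) x))
       \<and> (\<forall>r\<ge>1. boolean_cumulant1 \<phi> r (sample_variance n X) =
                 of_nat n * (1 - 1 / of_nat n) ^ r * boolean_cumulant1 \<psi> (2 * r) x)"
proof -
  let ?\<kappa> = "\<lambda>m. boolean_cumulant1 \<psi> m x"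
  interpret boolean_iid \<phi> "{1..n}" X ?\<kappa>
  proof
    show "boolean_cumulant1 \<phi> m (X a) = ?\<kappa> m" if "a \<in> {1..n}" "1 \<le> m" for a m
      using assms(7) that unfolding identically_distributed_def by blast
  qed (use assms in simp_all)
  have "boolean_cumulant1 \<phi> r (\<Sum>\<sigma> | \<sigma> permutes {1..n}. (permuted_linear_form n \<alpha> X \<sigma>)\<^sup>2)
      = of_nat n * (fact (n - 1)) ^ r * (complex_of_real (\<Sum>i=1..n. (\<alpha> i)\<^sup>2)) ^ r * ?\<kappa> (2 * r)"
    if \<alpha>: "(\<Sum>i=1..n. \<alpha> i) = 0 \<or> (\<forall>m. odd m \<longrightarrow> ?\<kappa> m = 0)" and "r \<ge> 1" for \<alpha> :: "nat \<Rightarrow> real" and r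
  proof -
    define q where "q = complex_of_real (\<Sum>i=1..n. (\<alpha> i)\<^sup>2)"
    define s where "s = complex_of_real (\<Sum>i=1..n. \<alpha> i)"
    define d where "d = fact (n - 2) * (s\<^sup>2 - q)"
    have P: "(\<Sum>\<sigma> | \<sigma> permutes {1..n}. (permuted_linear_form n \<alpha> X \<sigma>)\<^sup>2)
        = (fact (n - 1) * q - d) *\<^sub>C Q + d *\<^sub>C S\<^sup>2"
      using sum_permuted_squares[of "{1..n}" "\<lambda>i. complex_of_real (\<alpha> i)" X]
      by (simp add: permuted_linear_form_def q_def s_def d_def)
    \<comment> \<open>The case \<open>n = 1\<close> is separate: there \<open>(n - 1)! = (n - 1) (n - 2)!\<close> fails, but \<open>s\<^sup>2 = q\<close>.\<close>
    have row: "(fact (n - 1) * q - d) + of_nat n * d = fact (n - 1) * s\<^sup>2"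
    proof (cases "n = 1")
      case True
      then show ?thesis by (simp add: q_def s_def d_def)
    next
      case False
      then have "fact (n - 1) = (of_nat n - 1) * (fact (n - 2) :: complex)"
        using \<open>n \<ge> 1\<close> by (subst fact_reduce) (auto simp: numeral_2_eq_2 of_nat_diff)
      then show ?thesis
        unfolding d_def by (simp only:) (simp add: algebra_simps)
    qed
    have "(fact (n - 1) * q - d + N * d) * ?\<kappa> m = 0" if "odd m" for m
      using \<alpha> that row by (auto simp: s_def simp del: of_real_sum)
    from cumulant_symmetric_quadratic_form[OF this \<open>r \<ge> 1\<close>] show ?thesis
      unfolding P by (simp add: q_def power_mult_distrib mult.assoc)
  qed
  moreover have "boolean_cumulant1 \<phi> r (sample_variance n X)
      = of_nat n * (1 - 1 / of_nat n) ^ r * ?\<kappa> (2 * r)" if "r \<ge> 1" for r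
    using cumulant_symmetric_quadratic_form[of 1 "- 1 / of_nat n" r] that \<open>n \<ge> 1\<close>
    by (simp add: sample_variance_eq)
  ultimately show ?thesis by blast
qed

end
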